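(* For a bounded geometry quasi-geodesic coarse median space $(X,d,\mu)$, the metric $d$ is unique up to quasi-isometry. That is, if $d$ and $d'$ are two metrics on the same set $X$ and $\mu$ is a ternary operator on $X$ such that both $(X,d,\mu)$ and $(X,d',\mu)$ are bounded geometry quasi-geodesic coarse median spaces, then $d$ and $d'$ are quasi-isometric: there are constants $L,C>0$ with $L^{-1}d(x,y)-C\le d'(x,y)\le L\,d(x,y)+C$ for all $x,y\in X$.
   Context: Coarse median space: a triple $(X,d,\mu)$ with $(X,d)$ a metric space and $\mu:X^3\to X$ satisfying: (M1) $\mu(a,a,b)=a$; (M2) $\mu$ is invariant under all permutations of its three arguments; (C1) there is an affine function $\rho:[0,\infty)\to[0,\infty)$ with $d(\mu(a,b,c),\mu(a',b,c))\le\rho(d(a,a'))$ for all $a,a',b,c\in X$; (C2) there is a constant $\kappa_4>0$ with $d(\mu(\mu(a,b,c),b,d),\mu(a,b,\mu(c,b,d)))\le\kappa_4$ for all $a,b,c,d\in X$. Bounded geometry: for every $r>0$ there is $n\in\mathbb N$ such that every ball $B(x,r)$ has at most $n$ points. Quasi-geodesic: there are constants $L,C>0$ such that for any $x,y\in X$ there is a map $\gamma:[0,d(x,y)]\to X$ with $\gamma(0)=x$, $\gamma(d(x,y))=y$ and $L^{-1}|s-t|-C\le d(\gamma(s),\gamma(t))\le L|s-t|+C$ for all $s,t$. *)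

theory Defs
  imports "HOL-Analysis.Analysis"
begin

locale coarse_median_space = Metric_space X d
  for X :: "'a set" and d :: "'a \<Rightarrow> 'a \<Rightarrow> real" +
  fixes \<mu> :: "'a \<Rightarrow> 'a \<Rightarrow> 'a \<Rightarrow> 'a"
  assumes closed: "\<lbrakk>a \<in> X; b \<in> X; c \<in> X\<rbrakk> \<Longrightarrow> \<mu> a b c \<in> X"
    and M1: "\<lbrakk>a \<in> X; b \<in> X\<rbrakk> \<Longrightarrow> \<mu> a a b = a"
    and M2: "\<lbrakk>a \<in> X; b \<in> X; c \<in> X\<rbrakk> \<Longrightarrow>
        \<mu> a b c = \<mu> a c b \<and> \<mu> a b c = \<mu> b a c \<and> \<mu> a b c = \<mu> b c a \<and>
        \<mu> a b c = \<mu> c a b \<and> \<mu> a b c = \<mu> c b a"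
    (* rho is affine from [0,\<infinity>) to [0,\<infinity>); its values at negative reals are irrelevant *)
    and C1: "\<exists>\<rho> :: real \<Rightarrow> real.
        (\<exists>K H. \<forall>t\<ge>0. \<rho> t = K * t + H) \<and> (\<forall>t\<ge>0. \<rho> t \<ge> 0) \<and>
        (\<forall>a\<in>X. \<forall>a'\<in>X. \<forall>b\<in>X. \<forall>c\<in>X. d (\<mu> a b c) (\<mu> a' b c) \<le> \<rho> (d a a'))"
    and C2: "\<exists>\<kappa>\<^sub>4>0. \<forall>a\<in>X. \<forall>b\<in>X. \<forall>c\<in>X. \<forall>e\<in>X.
        d (\<mu> (\<mu> a b c) b e) (\<mu> a b (\<mu> c b e)) \<le> \<kappa>\<^sub>4"

(* Since all radii are quantified over, open and closed balls give the same notion.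
   Finiteness is required explicitly because card is 0 on infinite sets. *)
locale bounded_geometry_space = Metric_space X d
  for X :: "'a set" and d :: "'a \<Rightarrow> 'a \<Rightarrow> real" +
  assumes bounded_geometry:
    "\<forall>r>0. \<exists>n::nat. \<forall>x\<in>X. finite (mball x r) \<and> card (mball x r) \<le> n"

locale quasi_geodesic_space = Metric_space X d
  for X :: "'a set" and d :: "'a \<Rightarrow> 'a \<Rightarrow> real" +
  assumes quasi_geodesic:
    "\<exists>L>0. \<exists>C>0. \<forall>x\<in>X. \<forall>y\<in>X. \<exists>\<gamma> :: real \<Rightarrow> 'a.
        \<gamma> \<in> {0..d x y} \<rightarrow> X \<and> \<gamma> 0 = x \<and> \<gamma> (d x y) = y \<and>
        (\<forall>s\<in>{0..d x y}. \<forall>t\<in>{0..d x y}.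
            inverse L * \<bar>s - t\<bar> - C \<le> d (\<gamma> s) (\<gamma> t) \<and>
            d (\<gamma> s) (\<gamma> t) \<le> L * \<bar>s - t\<bar> + C)"

definition quasi_isometric_metrics ::
  "'a set \<Rightarrow> ('a \<Rightarrow> 'a \<Rightarrow> real) \<Rightarrow> ('a \<Rightarrow> 'a \<Rightarrow> real) \<Rightarrow> bool" where
  "quasi_isometric_metrics X d d' \<longleftrightarrow>
    (\<exists>L>0. \<exists>C>0. \<forall>x\<in>X. \<forall>y\<in>X.
        inverse L * d x y - C \<le> d' x y \<and> d' x y \<le> L * d x y + C)"

end

theory Submission
  imports Defs
begin

text \<open>
  The operator \<open>\<mu>\<close> alone determines, for any two points \<open>x\<close> and \<open>y\<close>, the interval
  \<open>{\<mu> x y z | z \<in> X}\<close>, and the number of points of this interval is a coarse measure of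
  the distance from \<open>x\<close> to \<open>y\<close> with respect to every admissible metric at once.

  If \<open>x\<close> and \<open>y\<close> are close for \<open>d\<close>, then by (C1) every \<open>\<mu> x y z\<close> is close to
  \<open>\<mu> x x z = x\<close>, so the interval lies in a ball of controlled radius and bounded geometry
  of \<open>d\<close> bounds its cardinality (\<open>interval_card_bounded\<close>). If, conversely, the interval has few
  points, then \<open>x\<close> and \<open>y\<close> are close for \<open>d'\<close>: the map \<open>z \<mapsto> \<mu> x y z\<close> fixes \<open>x\<close> and \<open>y\<close>
  and sends a discrete \<open>d'\<close>-quasi-geodesic from \<open>x\<close> to \<open>y\<close> to a chain inside the interval whose
  steps are still uniformly bounded; after its loops are removed this chain has fewer steps
  than the interval has points (\<open>dist_le_interval_card\<close>).

  Hence points at bounded \<open>d\<close>-distance are at bounded \<open>d'\<close>-distance. Along a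
  \<open>d\<close>-quasi-geodesic this local statement adds up to an affine bound of \<open>d'\<close> by \<open>d\<close>, and
  exchanging the two metrics gives the other inequality.
\<close>

definition median_interval :: "'a set \<Rightarrow> ('a \<Rightarrow> 'a \<Rightarrow> 'a \<Rightarrow> 'a) \<Rightarrow> 'a \<Rightarrow> 'a \<Rightarrow> 'a set"
  where "median_interval X \<mu> x y = \<mu> x y ` X"

text \<open>
  A chain that returns to a point can be shortened there, so only the number of points it may
  visit counts, whatever its length. The induction leaves the starting point for good after the
  last visit to it.
\<close>

lemma (in Metric_space) chain_dist_le_card:
  assumes "finite F" "F \<subseteq> M" "0 \<le> h"
    and "\<And>i. i \<le> n \<Longrightarrow> p i \<in> F"
    and "\<And>i. i < n \<Longrightarrow> d (p i) (p (Suc i)) \<le> h"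
  shows "d (p 0) (p n) \<le> real (card F) * h"
  using assms
proof (induction "card F" arbitrary: F p n)
  case 0
  then have "F = {}" by simp
  then show ?case using "0.prems"(4)[of 0] by simp
next
  case (Suc N)
  define k where "k = Max {i. i \<le> n \<and> p i = p 0}"
  have fin: "finite {i. i \<le> n \<and> p i = p 0}" by simp
  have "k \<in> {i. i \<le> n \<and> p i = p 0}"
    unfolding k_def by (rule Max_in[OF fin]) auto
  then have k: "k \<le> n" "p k = p 0" by auto
  have last: "p i \<noteq> p 0" if "k < i" "i \<le> n" for i
  proof
    assume "p i = p 0"
    then have "i \<le> k"
      unfolding k_def using that by (intro Max_ge[OF fin]) simp
    then show False using that by simp
  qed
  have mem: "p i \<in> M" if "i \<le> n" for i
    using Suc.prems(2,4) that by blast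
  show ?case
  proof (cases "k = n")
    case True
    then show ?thesis using k mem Suc.prems(3) by auto
  next
    case False
    then have "k < n" using k by simp
    let ?q = "\<lambda>i. p (Suc k + i)"
    have card: "card (F - {p 0}) = N"
      using Suc.hyps(2) Suc.prems(1,4) by (simp add: card_Diff_singleton)
    have "d (?q 0) (?q (n - Suc k)) \<le> real (card (F - {p 0})) * h"
    proof (rule Suc.hyps(1))
      show "N = card (F - {p 0})" using card by simp
      show "?q i \<in> F - {p 0}" if "i \<le> n - Suc k" for i
        using that \<open>k < n\<close> last[of "Suc k + i"] Suc.prems(4)[of "Suc k + i"] by simp
      show "d (?q i) (?q (Suc i)) \<le> h" if "i < n - Suc k" for i
        using that Suc.prems(5)[of "Suc k + i"] by simp
    qed (use Suc.prems in auto)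
    then have rest: "d (p (Suc k)) (p n) \<le> real N * h"
      using card \<open>k < n\<close> by simp
    have "d (p 0) (p n) \<le> d (p k) (p (Suc k)) + d (p (Suc k)) (p n)"
      using k triangle[of "p k" "p (Suc k)" "p n"] mem \<open>k < n\<close> by simp
    also have "\<dots> \<le> h + real N * h"
      using Suc.prems(5)[OF \<open>k < n\<close>] rest by simp
    finally show ?thesis
      using Suc.hyps(2)[symmetric] by (simp add: algebra_simps)
  qed
qed

lemma (in Metric_space) chain_dist_le_length:
  assumes "\<And>i. p i \<in> M" "\<And>i. d (p i) (p (Suc i)) \<le> h"
  shows "d (p 0) (p n) \<le> real n * h"
proof (induction n)
  case 0
  then show ?case using assms(1) by simp
next
  case (Suc n)
  have "d (p 0) (p (Suc n)) \<le> d (p 0) (p n) + d (p n) (p (Suc n))"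
    using triangle assms(1) by blast
  then show ?case using Suc assms(2)[of n] by (simp add: algebra_simps)
qed

text \<open>
  Quasi-geodesics enter the argument only through their samples at integer times; the last
  sample is taken at the endpoint, whence the truncation by \<open>d x y\<close>.
\<close>

lemma (in quasi_geodesic_space) discrete_quasi_geodesics:
  obtains K where "0 < K"
    and "\<And>x y. \<lbrakk>x \<in> X; y \<in> X\<rbrakk> \<Longrightarrow>
      \<exists>n p. real n \<le> d x y + 1 \<and> p 0 = x \<and> p n = y \<and>
        (\<forall>i. p i \<in> X) \<and> (\<forall>i. d (p i) (p (Suc i)) \<le> K)"
proof -
  obtain L C where LC: "0 < L" "0 < C" and
    geod: "\<And>x y. \<lbrakk>x \<in> X; y \<in> X\<rbrakk> \<Longrightarrow> \<exists>\<gamma> :: real \<Rightarrow> 'a.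
        \<gamma> \<in> {0..d x y} \<rightarrow> X \<and> \<gamma> 0 = x \<and> \<gamma> (d x y) = y \<and>
        (\<forall>s\<in>{0..d x y}. \<forall>t\<in>{0..d x y}.
            inverse L * \<bar>s - t\<bar> - C \<le> d (\<gamma> s) (\<gamma> t) \<and>
            d (\<gamma> s) (\<gamma> t) \<le> L * \<bar>s - t\<bar> + C)"
    using quasi_geodesic by blast
  show ?thesis
  proof (rule that[of "L + C"])
    show "0 < L + C" using LC by simp
    fix x y assume xy: "x \<in> X" "y \<in> X"
    then obtain \<gamma> :: "real \<Rightarrow> 'a" where
      \<gamma>: "\<gamma> \<in> {0..d x y} \<rightarrow> X" "\<gamma> 0 = x" "\<gamma> (d x y) = y"
      and lip: "\<And>s t. \<lbrakk>s \<in> {0..d x y}; t \<in> {0..d x y}\<rbrakk> \<Longrightarrow> d (\<gamma> s) (\<gamma> t) \<le> L * \<bar>s - t\<bar> + C"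
      using geod[OF xy] by blast
    define \<tau> where "\<tau> i = min (real i) (d x y)" for i :: nat
    have \<tau>: "\<tau> i \<in> {0..d x y}" for i
      unfolding \<tau>_def by simp
    let ?n = "nat \<lceil>d x y\<rceil>"
    have "real ?n \<le> d x y + 1"
      using nonneg[of x y] by linarith
    moreover have "\<tau> 0 = 0" "\<tau> ?n = d x y"
      unfolding \<tau>_def by (simp_all add: real_nat_ceiling_ge)
    moreover have "d (\<gamma> (\<tau> i)) (\<gamma> (\<tau> (Suc i))) \<le> L + C" for i
    proof -
      have "L * \<bar>\<tau> i - \<tau> (Suc i)\<bar> \<le> L * 1"
        by (rule mult_left_mono) (use LC in \<open>auto simp: \<tau>_def min_def\<close>)
      then show ?thesis using lip[OF \<tau> \<tau>, of i "Suc i"] by simp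
    qed
    moreover have "\<gamma> (\<tau> i) \<in> X" for i
      using \<gamma>(1) \<tau> by blast
    ultimately show "\<exists>n p. real n \<le> d x y + 1 \<and> p 0 = x \<and> p n = y \<and>
        (\<forall>i. p i \<in> X) \<and> (\<forall>i. d (p i) (p (Suc i)) \<le> L + C)"
      using \<gamma>(2,3) by (intro exI[of _ ?n] exI[of _ "\<lambda>i. \<gamma> (\<tau> i)"]) simp
  qed
qed

text \<open>
  Nonnegative coefficients make the affine bound in (C1) monotone in the distance, which is how
  it is applied; replacing the coefficients by their absolute values only enlarges the bound.
\<close>

lemma (in coarse_median_space) median_affine_control:
  obtains K H where "0 \<le> K" "0 \<le> H"
    and "\<And>a a' b c. \<lbrakk>a \<in> X; a' \<in> X; b \<in> X; c \<in> X\<rbrakk> \<Longrightarrow>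
      d (\<mu> a b c) (\<mu> a' b c) \<le> K * d a a' + H"
proof -
  obtain \<rho> :: "real \<Rightarrow> real" where
    affine: "\<exists>K H. \<forall>t\<ge>0. \<rho> t = K * t + H"
    and "\<forall>a\<in>X. \<forall>a'\<in>X. \<forall>b\<in>X. \<forall>c\<in>X. d (\<mu> a b c) (\<mu> a' b c) \<le> \<rho> (d a a')"
    using C1 by blast
  then have control: "d (\<mu> a b c) (\<mu> a' b c) \<le> \<rho> (d a a')"
    if "a \<in> X" "a' \<in> X" "b \<in> X" "c \<in> X" for a a' b c
    using that by simp
  obtain K H where \<rho>: "\<And>t. 0 \<le> t \<Longrightarrow> \<rho> t = K * t + H"
    using affine by blast
  show ?thesis
  proof (rule that[of "\<bar>K\<bar>" "\<bar>H\<bar>"])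
    fix a a' b c assume "a \<in> X" "a' \<in> X" "b \<in> X" "c \<in> X"
    then have "d (\<mu> a b c) (\<mu> a' b c) \<le> K * d a a' + H"
      using control[of a a' b c] \<rho>[OF nonneg[of a a']] by simp
    also have "\<dots> \<le> \<bar>K\<bar> * d a a' + \<bar>H\<bar>"
      by (intro add_mono mult_right_mono) auto
    finally show "d (\<mu> a b c) (\<mu> a' b c) \<le> \<bar>K\<bar> * d a a' + \<bar>H\<bar>" .
  qed simp_all
qed

text \<open>
  Since \<open>\<mu> x x z = x\<close>, moving the second argument from \<open>x\<close> to \<open>y\<close> shows that the whole interval
  lies in a ball around \<open>x\<close> whose radius depends only on \<open>d x y\<close>.
\<close>

lemma interval_card_bounded:
  assumes "coarse_median_space X d \<mu>" "bounded_geometry_space X d"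
  obtains N where "\<And>x y. \<lbrakk>x \<in> X; y \<in> X; d x y \<le> R\<rbrakk> \<Longrightarrow>
    finite (median_interval X \<mu> x y) \<and> card (median_interval X \<mu> x y) \<le> N"
proof -
  interpret coarse_median_space X d \<mu> by fact
  interpret bounded_geometry_space X d by fact
  obtain K H where KH: "0 \<le> K" "0 \<le> H"
    and control: "\<And>a a' b c. \<lbrakk>a \<in> X; a' \<in> X; b \<in> X; c \<in> X\<rbrakk> \<Longrightarrow>
      d (\<mu> a b c) (\<mu> a' b c) \<le> K * d a a' + H"
    using median_affine_control by blast
  define r where "r = K * \<bar>R\<bar> + H + 1"
  have "0 < r" using KH unfolding r_def by (simp add: add_nonneg_pos)
  then obtain N where N: "\<And>x. x \<in> X \<Longrightarrow> finite (mball x r) \<and> card (mball x r) \<le> N"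
    using bounded_geometry by blast
  show ?thesis
  proof (rule that[of N])
    fix x y assume xy: "x \<in> X" "y \<in> X" "d x y \<le> R"
    have "median_interval X \<mu> x y \<subseteq> mball x r"
    proof
      fix w assume "w \<in> median_interval X \<mu> x y"
      then obtain z where z: "z \<in> X" "w = \<mu> x y z"
        unfolding median_interval_def by blast
      have "\<mu> x y z = \<mu> y x z"
        using M2[OF xy(1,2) z(1)] by blast
      then have "d x w \<le> K * d x y + H"
        using control[OF xy(1,2,1) z(1)] M1[OF xy(1) z(1)] z(2) by simp
      also have "K * d x y \<le> K * \<bar>R\<bar>"
        using KH(1) xy(3) by (intro mult_left_mono) auto
      finally show "w \<in> mball x r"
        using xy z closed unfolding r_def by simp
    qed
    then show "finite (median_interval X \<mu> x y) \<and> card (median_interval X \<mu> x y) \<le> N"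
      using N[OF xy(1)] by (meson card_mono finite_subset le_trans)
  qed
qed

text \<open>
  The map \<open>z \<mapsto> \<mu> x y z\<close> is a coarsely Lipschitz projection onto the interval that fixes both
  endpoints, so it turns a discrete quasi-geodesic from \<open>x\<close> to \<open>y\<close> into a chain between
  the same points that cannot leave the interval.
\<close>

lemma dist_le_interval_card:
  assumes "coarse_median_space X d \<mu>" "quasi_geodesic_space X d"
  obtains h where "0 \<le> h"
    and "\<And>x y. \<lbrakk>x \<in> X; y \<in> X; finite (median_interval X \<mu> x y)\<rbrakk> \<Longrightarrow>
      d x y \<le> real (card (median_interval X \<mu> x y)) * h"
proof -
  interpret coarse_median_space X d \<mu> by fact
  interpret quasi_geodesic_space X d by fact
  obtain K H where KH: "0 \<le> K" "0 \<le> H"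
    and control: "\<And>a a' b c. \<lbrakk>a \<in> X; a' \<in> X; b \<in> X; c \<in> X\<rbrakk> \<Longrightarrow>
      d (\<mu> a b c) (\<mu> a' b c) \<le> K * d a a' + H"
    using median_affine_control by blast
  obtain S where S: "0 < S"
    and chains: "\<And>x y. \<lbrakk>x \<in> X; y \<in> X\<rbrakk> \<Longrightarrow>
      \<exists>n p. real n \<le> d x y + 1 \<and> p 0 = x \<and> p n = y \<and>
        (\<forall>i. p i \<in> X) \<and> (\<forall>i. d (p i) (p (Suc i)) \<le> S)"
    using discrete_quasi_geodesics by blast
  show ?thesis
  proof (rule that[of "K * S + H"])
    show h: "0 \<le> K * S + H" using KH S by simp
    fix x y assume xy: "x \<in> X" "y \<in> X" and fin: "finite (median_interval X \<mu> x y)"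
    obtain n p where p: "p 0 = x" "p n = y" "\<And>i. p i \<in> X" "\<And>i. d (p i) (p (Suc i)) \<le> S"
      using chains[OF xy] by blast
    have "d (\<mu> x y (p 0)) (\<mu> x y (p n))
        \<le> real (card (median_interval X \<mu> x y)) * (K * S + H)"
    proof (rule chain_dist_le_card[OF fin _ h])
      show "median_interval X \<mu> x y \<subseteq> X"
        unfolding median_interval_def using closed xy by blast
      show "\<mu> x y (p i) \<in> median_interval X \<mu> x y" for i
        unfolding median_interval_def using p(3) by blast
      show "d (\<mu> x y (p i)) (\<mu> x y (p (Suc i))) \<le> K * S + H" for i
      proof -
        have "\<mu> x y (p j) = \<mu> (p j) x y" for j
          using M2[OF xy p(3)[of j]] by blast
        then have "d (\<mu> x y (p i)) (\<mu> x y (p (Suc i))) \<le> K * d (p i) (p (Suc i)) + H"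
          using control[OF p(3) p(3) xy] by simp
        then show ?thesis
          using mult_left_mono[OF p(4)[of i] KH(1)] by linarith
      qed
    qed
    moreover have "\<mu> x y x = x" "\<mu> x y y = y"
      using M1[OF xy] M1[OF xy(2,1)] M2[OF xy xy(1)] M2[OF xy xy(2)] by argo+
    ultimately show "d x y \<le> real (card (median_interval X \<mu> x y)) * (K * S + H)"
      using p(1,2) by simp
  qed
qed

text \<open>
  The cardinality of the interval does not mention a metric, which is what allows the passage
  from a bound for one metric to a bound for the other.
\<close>

lemma bounded_dist_transfer:
  assumes "coarse_median_space X d \<mu>" "bounded_geometry_space X d"
    and "coarse_median_space X d' \<mu>" "quasi_geodesic_space X d'"
  obtains S where "0 < S" and "\<And>x y. \<lbrakk>x \<in> X; y \<in> X; d x y \<le> R\<rbrakk> \<Longrightarrow> d' x y \<le> S"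
proof -
  obtain N where N: "\<And>x y. \<lbrakk>x \<in> X; y \<in> X; d x y \<le> R\<rbrakk> \<Longrightarrow>
      finite (median_interval X \<mu> x y) \<and> card (median_interval X \<mu> x y) \<le> N"
    using interval_card_bounded[OF assms(1,2)] by blast
  obtain h where h: "0 \<le> h"
    and dist: "\<And>x y. \<lbrakk>x \<in> X; y \<in> X; finite (median_interval X \<mu> x y)\<rbrakk> \<Longrightarrow>
      d' x y \<le> real (card (median_interval X \<mu> x y)) * h"
    using dist_le_interval_card[OF assms(3,4)] by blast
  show ?thesis
  proof (rule that[of "real N * h + 1"])
    show "0 < real N * h + 1" using h by (simp add: add_nonneg_pos)
    fix x y assume xy: "x \<in> X" "y \<in> X" "d x y \<le> R"
    have "real (card (median_interval X \<mu> x y)) * h \<le> real N * h"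
      using N[OF xy] h by (intro mult_right_mono) auto
    then show "d' x y \<le> real N * h + 1"
      using dist[OF xy(1,2)] N[OF xy] by linarith
  qed
qed

text \<open>
  A discrete \<open>d\<close>-quasi-geodesic has at most \<open>d x y + 1\<close> steps, and each of them has bounded
  \<open>d'\<close>-length because it has bounded \<open>d\<close>-length.
\<close>

lemma affine_dist_bound:
  assumes "coarse_median_space X d \<mu>" "bounded_geometry_space X d" "quasi_geodesic_space X d"
    and "coarse_median_space X d' \<mu>" "quasi_geodesic_space X d'"
  obtains A where "0 < A" and "\<And>x y. \<lbrakk>x \<in> X; y \<in> X\<rbrakk> \<Longrightarrow> d' x y \<le> A * d x y + A"
proof -
  interpret quasi_geodesic_space X d by fact
  interpret M': quasi_geodesic_space X d' by fact
  obtain K where "0 < K" and chains: "\<And>x y. \<lbrakk>x \<in> X; y \<in> X\<rbrakk> \<Longrightarrow>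
      \<exists>n p. real n \<le> d x y + 1 \<and> p 0 = x \<and> p n = y \<and>
        (\<forall>i. p i \<in> X) \<and> (\<forall>i. d (p i) (p (Suc i)) \<le> K)"
    using discrete_quasi_geodesics by blast
  obtain S where S: "0 < S" "\<And>x y. \<lbrakk>x \<in> X; y \<in> X; d x y \<le> K\<rbrakk> \<Longrightarrow> d' x y \<le> S"
    using bounded_dist_transfer[OF assms(1,2,4,5)] by blast
  show ?thesis
  proof (rule that[OF S(1)])
    fix x y assume "x \<in> X" "y \<in> X"
    then obtain n p where n: "real n \<le> d x y + 1"
      and p: "p 0 = x" "p n = y" "\<And>i. p i \<in> X" "\<And>i. d (p i) (p (Suc i)) \<le> K"
      using chains[of x y] by blast
    have "d' (p 0) (p n) \<le> real n * S"
      by (rule M'.chain_dist_le_length) (use p S(2) in auto)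
    also have "\<dots> \<le> (d x y + 1) * S"
      using n S(1) by (intro mult_right_mono) auto
    finally show "d' x y \<le> S * d x y + S"
      using p(1,2) by (simp add: algebra_simps)
  qed
qed

theorem theorem1p5:
  fixes X :: "'a set"
    and d d' :: "'a \<Rightarrow> 'a \<Rightarrow> real"
    and \<mu> :: "'a \<Rightarrow> 'a \<Rightarrow> 'a \<Rightarrow> 'a"
  assumes "coarse_median_space X d \<mu>"
    and "bounded_geometry_space X d"
    and "quasi_geodesic_space X d"
    and "coarse_median_space X d' \<mu>"
    and "bounded_geometry_space X d'"
    and "quasi_geodesic_space X d'"
  shows "quasi_isometric_metrics X d d'"
proof -
  interpret M: quasi_geodesic_space X d by fact
  interpret M': quasi_geodesic_space X d' by fact
  obtain A where A: "0 < A" "\<And>x y. \<lbrakk>x \<in> X; y \<in> X\<rbrakk> \<Longrightarrow> d' x y \<le> A * d x y + A"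
    using affine_dist_bound[OF assms(1-4,6)] by blast
  obtain B where B: "0 < B" "\<And>x y. \<lbrakk>x \<in> X; y \<in> X\<rbrakk> \<Longrightarrow> d x y \<le> B * d' x y + B"
    using affine_dist_bound[OF assms(4-6,1,3)] by blast
  \<comment> \<open>Dividing the second bound by \<open>L\<close> leaves the additive error \<open>1\<close>, so that \<open>L \<ge> 1\<close> can serve
    as both constants.\<close>
  define L where "L = A + B + 1"
  have L: "1 \<le> L" "A \<le> L" "B \<le> L" using A(1) B(1) unfolding L_def by auto
  have "inverse L * d x y - L \<le> d' x y \<and> d' x y \<le> L * d x y + L"
    if xy: "x \<in> X" "y \<in> X" for x y
  proof
    have "d x y \<le> L * d' x y + L"
      using B(2)[OF xy] mult_right_mono[OF L(3) M'.nonneg[of x y]] L(3) by linarith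
    then have "inverse L * d x y \<le> inverse L * (L * d' x y + L)"
      using L(1) by (intro mult_left_mono) auto
    also have "\<dots> = d' x y + 1" using L(1) by (simp add: field_simps)
    finally show "inverse L * d x y - L \<le> d' x y" using L(1) by linarith
    show "d' x y \<le> L * d x y + L"
      using A(2)[OF xy] mult_right_mono[OF L(2) M.nonneg[of x y]] L(2) by linarith
  qed
  then show ?thesis
    unfolding quasi_isometric_metrics_def using L(1)
    by (intro exI[of _ L] conjI) auto
qed

end
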